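(* Let $n$ and $k$ be positive integers with $n\geq 2$ and $2n\geq k>n$. Then $r_2(n,k)=R_2(n+1,k)$ except in the following cases: \begin{itemize} \item $r_2(2,3)=4$ while $R_2(3,3)=9$; \item $r_2(2,4)=5$ while $R_2(3,4)=10$; \item $r_2(3,5)=5$ while $R_2(4,5)=9$; and \item if $10\leq k\leq 14$, then $r_2(k-5,k)=5$ while $R_2(k-4,k)=6$. \end{itemize}
   Context: For a positive integer $r$ write $[r]=\{1,\ldots,r\}$. The 2-color Rado number of an equation is the smallest positive integer $r$ such that for every coloring of the elements of $[r]$ with two colors there exists a solution of the equation using elements of $[r]$ that are all colored the same (a monochromatic solution). The values of distinct variables in a solution are not required to be distinct. (By a theorem of Rado, this number exists for every equation $a_1x_1+\cdots+a_nx_n=b_1y_1+\cdots+b_ky_k$ with all $a_i,b_j$ positive integers, $n,k\geq 1$ and $n+k\geq 3$.) Notation: $R_2(m,a)$ denotes the 2-color Rado number of $x_1+x_2+\cdots+x_{m-1}=ax_m$, and $r_2(n,k)$ denotes the 2-color Rado number of $x_1+x_2+\cdots+x_n=y_1+y_2+\cdots+y_k$. *)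

theory Defs
  imports Main
begin

text \<open>The coefficient lists \<open>as\<close>, \<open>bs\<close> stand for the equation
  \<open>a\<^sub>1 x\<^sub>1 + \<dots> + a\<^sub>n x\<^sub>n = b\<^sub>1 y\<^sub>1 + \<dots> + b\<^sub>k y\<^sub>k\<close>.\<close>

definition solution :: "nat list \<Rightarrow> nat list \<Rightarrow> nat list \<Rightarrow> nat list \<Rightarrow> bool" where
  "solution as bs xs ys \<longleftrightarrow>
     length xs = length as \<and> length ys = length bs \<and>
     (\<Sum>i<length as. as ! i * xs ! i) = (\<Sum>j<length bs. bs ! j * ys ! j)"

text \<open>Colorings are total functions on \<open>nat\<close>, but only their values on
  \<open>{1..r}\<close> matter below.\<close>

definition has_mono_solution ::
    "nat list \<Rightarrow> nat list \<Rightarrow> nat \<Rightarrow> (nat \<Rightarrow> bool) \<Rightarrow> bool" where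
  "has_mono_solution as bs r c \<longleftrightarrow>
     (\<exists>xs ys. solution as bs xs ys \<and> set xs \<union> set ys \<subseteq> {1..r} \<and>
        (\<exists>col. \<forall>v \<in> set xs \<union> set ys. c v = col))"

text \<open>By Rado's theorem the minimum exists whenever all coefficients are positive, both
  lists are nonempty and their lengths add up to at least 3; otherwise the
  value may be unspecified.\<close>

definition rado_number2 :: "nat list \<Rightarrow> nat list \<Rightarrow> nat" where
  "rado_number2 as bs = (LEAST r. 0 < r \<and> (\<forall>c. has_mono_solution as bs r c))"

definition R2 :: "nat \<Rightarrow> nat \<Rightarrow> nat" where
  "R2 m a = rado_number2 (replicate (m - 1) 1) [a]"

definition r2 :: "nat \<Rightarrow> nat \<Rightarrow> nat" where
  "r2 n k = rado_number2 (replicate n 1) (replicate k 1)"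

end

theory Submission
  imports Defs
begin

text \<open>
  Write \<open>d = k - n\<close>, so \<open>1 \<le> d \<le> n\<close>.  Replacing \<open>y\<^sub>1 + \<dots> + y\<^sub>k\<close> by \<open>k y\<close> amounts to making all
  \<open>y\<^sub>j\<close> equal, so \<open>r\<^sub>2(n,k) \<le> R\<^sub>2(n+1,k)\<close>, and the two numbers coincide as soon as some \<open>r\<close> satisfies:
  every coloring of \<open>[r]\<close> has a monochromatic solution of the special equation \<open>\<Sum>x\<^sub>i = k y\<close>, while some
  coloring of \<open>[r - 1]\<close> avoids even the general equation \<open>\<Sum>x\<^sub>i = \<Sum>y\<^sub>j\<close>.

  Colorings that avoid the special equation are almost rigid.  Since \<open>n \<le> k \<le> 2n\<close>, a class that
  contains \<open>t\<close> and \<open>2t\<close> contains a solution with \<open>y = t\<close>; hence \<open>2\<close> differs from \<open>1\<close>, and \<open>4\<close> agrees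
  with \<open>1\<close>.  The class \<open>{1,3,4}\<close> contains a solution unless \<open>(n,k) = (2,3)\<close>, so \<open>3\<close> goes with \<open>2\<close>;
  and \<open>{2,3,5}\<close> always contains one, so \<open>5\<close> goes with \<open>1\<close>.  The classes \<open>{1,4,5}\<close>, \<open>{2,3}\<close> that
  remain fail too, for all but a few \<open>(n,k)\<close>: with \<open>y = 1\<close>, a solution in \<open>{1,4,5}\<close> writes \<open>d\<close> as a
  sum of threes and fours, which is possible unless \<open>d \<in> {1,2,5}\<close>.  A solution turns up earlier if
  one of three smaller classes contains one: \<open>{1,3}\<close> does when \<open>d\<close> is even, \<open>{1,4}\<close> when \<open>3\<close>
  divides \<open>d\<close>, and \<open>{2,3}\<close> when \<open>2k \<le> 3n\<close>.

  In the other direction only two obstructions to \<open>\<Sum>x\<^sub>i = \<Sum>y\<^sub>j\<close> are used.  One is size: a class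
  inside \<open>[a,b]\<close> has no solution if \<open>n b < k a\<close>, which disposes of \<open>{2,3}\<close> when \<open>3n < 2k\<close>.  The
  other is congruence: a class whose elements are all 1 modulo \<open>m\<close> has no solution unless
  \<open>m\<close> divides \<open>d\<close>, which disposes of \<open>{1,3}\<close> (modulo 2) and of \<open>{1,4}\<close> (modulo 3).  The outcome is
  that both numbers equal
  \<^item> 3, if \<open>2k \<le> 3n\<close> and \<open>d\<close> is even;
  \<^item> 4, if \<open>2k \<le> 3n\<close> and \<open>d\<close> is odd, or if \<open>3n < 2k\<close> and \<open>3\<close> divides \<open>d\<close>;
  \<^item> 5, in the remaining cases,

  with the exceptions \<open>(2,3)\<close>, where \<open>{1,3,4}\<close> has no solution of the special equation, and \<open>3n < 2k\<close>
  with \<open>d \<in> {1,2,5}\<close>.  As \<open>n \<ge> 2\<close> and \<open>d \<le> n\<close>, these last conditions leave \<open>(2,4)\<close>, \<open>(3,5)\<close> and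
  \<open>d = 5\<close>, \<open>5 \<le> n \<le> 9\<close>.  The general equation is still solvable in the class concerned, so
  \<open>r\<^sub>2\<close> keeps its value; the special equation needs a larger \<open>r\<close>, found by inspection.
\<close>

section \<open>Solutions as lists with prescribed sums\<close>

lemma sum_replicate_1_times:
  assumes "length xs = n"
  shows "(\<Sum>i<n. replicate n 1 ! i * xs ! i) = sum_list (xs :: nat list)"
  using assms by (simp add: sum_list_sum_nth atLeast0LessThan)

lemma has_mono_solution_const_iff:
  "has_mono_solution (replicate n 1) [k] r c \<longleftrightarrow>
     (\<exists>xs y. length xs = n \<and> sum_list xs = k * y \<and> y \<in> {1..r} \<and>
       (\<forall>v\<in>set xs. v \<in> {1..r} \<and> c v = c y))"
proof
  assume "has_mono_solution (replicate n 1) [k] r c"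
  then obtain xs ys col where sol: "solution (replicate n 1) [k] xs ys"
    and rng: "set xs \<union> set ys \<subseteq> {1..r}" and col: "\<forall>v \<in> set xs \<union> set ys. c v = col"
    unfolding has_mono_solution_def by blast
  from sol obtain y where ys: "ys = [y]"
    by (auto simp: solution_def length_Suc_conv)
  from sol have "length xs = n" "sum_list xs = k * y"
    using sum_replicate_1_times[of xs n] by (auto simp: solution_def ys)
  then show "\<exists>xs y. length xs = n \<and> sum_list xs = k * y \<and> y \<in> {1..r} \<and>
       (\<forall>v\<in>set xs. v \<in> {1..r} \<and> c v = c y)"
    using rng col unfolding ys by (intro exI[of _ xs] exI[of _ y]) auto
next
  assume "\<exists>xs y. length xs = n \<and> sum_list xs = k * y \<and> y \<in> {1..r} \<and>
       (\<forall>v\<in>set xs. v \<in> {1..r} \<and> c v = c y)"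
  then obtain xs y where xs: "length xs = n" "sum_list xs = k * y" "y \<in> {1..r}"
    "\<forall>v\<in>set xs. v \<in> {1..r} \<and> c v = c y" by blast
  have "solution (replicate n 1) [k] xs [y]"
    using xs sum_replicate_1_times[of xs n] by (simp add: solution_def)
  then show "has_mono_solution (replicate n 1) [k] r c"
    unfolding has_mono_solution_def using xs(3,4)
    by (intro exI[of _ xs] exI[of _ "[y]"]) auto
qed

lemma has_mono_solution_ones_iff:
  "has_mono_solution (replicate n 1) (replicate k 1) r c \<longleftrightarrow>
     (\<exists>xs ys col. length xs = n \<and> length ys = k \<and> sum_list xs = sum_list ys \<and>
       (\<forall>v\<in>set xs \<union> set ys. v \<in> {1..r} \<and> c v = col))"
proof -
  have "solution (replicate n 1) (replicate k 1) xs ys \<longleftrightarrow>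
      length xs = n \<and> length ys = k \<and> sum_list xs = sum_list ys" for xs ys
    using sum_replicate_1_times[of xs n] sum_replicate_1_times[of ys k]
    by (auto simp: solution_def)
  then show ?thesis
    unfolding has_mono_solution_def subset_eq ball_conj_distrib
    by (simp only: conj_assoc ex_simps)
qed

lemma mono_const_imp_mono_ones:
  assumes "has_mono_solution (replicate n 1) [k] r c"
  shows "has_mono_solution (replicate n 1) (replicate k 1) r c"
proof -
  from assms obtain xs y where xs: "length xs = n" "sum_list xs = k * y" "y \<in> {1..r}"
    "\<forall>v\<in>set xs. v \<in> {1..r} \<and> c v = c y"
    unfolding has_mono_solution_const_iff by blast
  show ?thesis
    unfolding has_mono_solution_ones_iff
    by (rule exI[of _ xs], rule exI[of _ "replicate k y"], rule exI[of _ "c y"])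
      (use xs in \<open>auto simp: sum_list_replicate\<close>)
qed

section \<open>Determining a Rado number\<close>

lemma has_mono_solution_mono:
  assumes "has_mono_solution as bs r c" and "r \<le> r'"
  shows "has_mono_solution as bs r' c"
proof -
  have "{1..r} \<subseteq> {1..r'}" using assms(2) by auto
  then show ?thesis using assms(1) unfolding has_mono_solution_def by blast
qed

lemma rado_number2_eqI:
  assumes "\<And>c. has_mono_solution as bs (Suc r) c" and "\<not> has_mono_solution as bs r c0"
  shows "rado_number2 as bs = Suc r"
  unfolding rado_number2_def
proof (rule Least_equality)
  show "0 < Suc r \<and> (\<forall>c. has_mono_solution as bs (Suc r) c)" using assms(1) by simp
next
  fix s assume s: "0 < s \<and> (\<forall>c. has_mono_solution as bs s c)"
  show "Suc r \<le> s"
    using has_mono_solution_mono[of as bs s c0 r] s assms(2) by (meson not_less_eq_eq)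
qed

lemma R2_eqI:
  assumes "\<And>c. has_mono_solution (replicate n 1) [k] (Suc r) c"
    and "\<not> has_mono_solution (replicate n 1) [k] r c0"
  shows "R2 (Suc n) k = Suc r"
  unfolding R2_def using rado_number2_eqI[OF assms] by simp

lemma r2_eqI:
  assumes "\<And>c. has_mono_solution (replicate n 1) (replicate k 1) (Suc r) c"
    and "\<not> has_mono_solution (replicate n 1) (replicate k 1) r c0"
  shows "r2 n k = Suc r"
  unfolding r2_def using rado_number2_eqI[OF assms] .

text \<open>The sandwich: the upper bound is for the equation that is harder to solve and the lower bound
  is for the easier one, so the two numbers agree.\<close>

lemma r2_eq_R2I:
  assumes "\<And>c. has_mono_solution (replicate n 1) [k] (Suc r) c"
    and "\<not> has_mono_solution (replicate n 1) (replicate k 1) r c0"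
  shows "r2 n k = R2 (Suc n) k"
proof -
  have "r2 n k = Suc r" using assms mono_const_imp_mono_ones by (blast intro: r2_eqI)
  moreover have "R2 (Suc n) k = Suc r" using assms mono_const_imp_mono_ones by (blast intro: R2_eqI)
  ultimately show ?thesis by simp
qed

section \<open>Colorings without monochromatic solutions\<close>

lemma sum_list_le_mult:
  fixes xs :: "nat list"
  assumes "\<forall>v\<in>set xs. v \<le> b"
  shows "sum_list xs \<le> length xs * b"
  using assms by (induction xs) auto

lemma sum_list_ge_mult:
  fixes xs :: "nat list"
  assumes "\<forall>v\<in>set xs. a \<le> v"
  shows "length xs * a \<le> sum_list xs"
  using assms by (induction xs) auto

lemma sum_list_mod_of_residue_1:
  fixes xs :: "nat list"
  assumes "\<forall>v\<in>set xs. v mod m = 1"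
  shows "sum_list xs mod m = length xs mod m"
  using assms
proof (induction xs)
  case (Cons x xs)
  have "(x + sum_list xs) mod m = (x mod m + sum_list xs mod m) mod m"
    by (simp add: mod_simps)
  also have "\<dots> = (1 + length xs mod m) mod m" using Cons by simp
  finally show ?case by (simp add: mod_simps)
qed simp

text \<open>Two reasons why a color class \<open>A\<close> contains no solution.  If \<open>A\<close> lies in \<open>[a,b]\<close>, the left side is
  at most \<open>n b\<close> and the right side at least \<open>k a\<close>; if all elements of \<open>A\<close> are 1 modulo \<open>m\<close>, then the
  two sides are congruent to \<open>n\<close> and \<open>k\<close>.\<close>

definition size_obstructed :: "nat \<Rightarrow> nat \<Rightarrow> nat set \<Rightarrow> bool" where
  "size_obstructed n k A \<longleftrightarrow> (\<exists>a b. A \<subseteq> {a..b} \<and> n * b < k * a)"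

definition residue_obstructed :: "nat \<Rightarrow> nat \<Rightarrow> nat set \<Rightarrow> bool" where
  "residue_obstructed n k A \<longleftrightarrow> (\<exists>m. (\<forall>v\<in>A. v mod m = 1) \<and> n mod m \<noteq> k mod m)"

lemma sum_list_ne_of_obstructed:
  assumes "size_obstructed (length xs) (length ys) A \<or> residue_obstructed (length xs) (length ys) A"
    and "set xs \<union> set ys \<subseteq> A"
  shows "sum_list xs \<noteq> sum_list ys"
  using assms(1)
proof
  assume "size_obstructed (length xs) (length ys) A"
  then obtain a b where ab: "A \<subseteq> {a..b}" "length xs * b < length ys * a"
    unfolding size_obstructed_def by blast
  have "\<forall>v\<in>set xs. v \<le> b" "\<forall>v\<in>set ys. a \<le> v" using ab(1) assms(2) by fastforce+
  then show ?thesis using sum_list_le_mult[of xs b] sum_list_ge_mult[of ys a] ab(2) by simp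
next
  assume "residue_obstructed (length xs) (length ys) A"
  then obtain m where m: "\<forall>v\<in>A. v mod m = 1" "length xs mod m \<noteq> length ys mod m"
    unfolding residue_obstructed_def by blast
  have "\<forall>v\<in>set xs. v mod m = 1" "\<forall>v\<in>set ys. v mod m = 1" using m(1) assms(2) by blast+
  then show ?thesis
    using sum_list_mod_of_residue_1[of xs m] sum_list_mod_of_residue_1[of ys m] m(2) by force
qed

lemma not_mono_ones_of_obstructed:
  assumes "\<And>col. size_obstructed n k {v \<in> {1..r}. c v = col} \<or>
      residue_obstructed n k {v \<in> {1..r}. c v = col}"
  shows "\<not> has_mono_solution (replicate n 1) (replicate k 1) r c"
proof
  assume "has_mono_solution (replicate n 1) (replicate k 1) r c"
  then obtain xs ys col where s: "length xs = n" "length ys = k" "sum_list xs = sum_list ys"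
    "\<forall>v\<in>set xs \<union> set ys. v \<in> {1..r} \<and> c v = col"
    unfolding has_mono_solution_ones_iff by blast
  from s(4) have "set xs \<union> set ys \<subseteq> {v \<in> {1..r}. c v = col}" by blast
  then show False using sum_list_ne_of_obstructed assms s(1-3) by blast
qed

lemma size_obstructedI:
  assumes "A \<subseteq> {a..b}" "n * b < k * a"
  shows "size_obstructed n k A"
  using assms unfolding size_obstructed_def by blast

lemma residue_obstructedI:
  assumes "\<forall>v\<in>A. v mod m = 1" "\<not> m dvd k - n" "n \<le> k"
  shows "residue_obstructed n k A"
proof -
  have "n mod m \<noteq> k mod m" using assms(2,3) by (metis mod_eq_dvd_iff_nat)
  then show ?thesis using assms(1) unfolding residue_obstructed_def by blast
qed

lemma avoids_ones_upto_2:
  assumes "n < k"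
  shows "\<not> has_mono_solution (replicate n 1) (replicate k 1) 2 (\<lambda>v. v = 1)"
proof (rule not_mono_ones_of_obstructed)
  fix col
  have "size_obstructed n k {v \<in> {1..2}. (v = 1) = col}"
    using assms
    by (intro size_obstructedI[of _ "if col then 1 else 2" "if col then 1 else 2"]) auto
  then show "size_obstructed n k {v \<in> {1..2}. (v = 1) = col} \<or>
      residue_obstructed n k {v \<in> {1..2}. (v = 1) = col}" ..
qed

lemma avoids_ones_upto_3_odd:
  assumes "n < k" "odd (k - n)"
  shows "\<not> has_mono_solution (replicate n 1) (replicate k 1) 3 (\<lambda>v. v = 2)"
proof (rule not_mono_ones_of_obstructed)
  fix col
  have "size_obstructed n k {v \<in> {1..3}. v = 2}"
    using assms by (intro size_obstructedI[of _ 2 2]) auto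
  moreover have "residue_obstructed n k {v \<in> {1..3}. v \<noteq> 2}"
  proof (rule residue_obstructedI[of _ 2])
    have "{v \<in> {1..3}. v \<noteq> 2} = {1, 3 :: nat}" by auto
    then show "\<forall>v\<in>{v \<in> {1..3}. v \<noteq> 2}. v mod 2 = (1 :: nat)" by simp
  qed (use assms in auto)
  ultimately show "size_obstructed n k {v \<in> {1..3}. (v = 2) = col} \<or>
      residue_obstructed n k {v \<in> {1..3}. (v = 2) = col}" by (cases col) auto
qed

lemma avoids_ones_upto_3_size:
  assumes "n < k" "3 * n < 2 * k"
  shows "\<not> has_mono_solution (replicate n 1) (replicate k 1) 3 (\<lambda>v. v = 1)"
proof (rule not_mono_ones_of_obstructed)
  fix col
  have "size_obstructed n k {v \<in> {1..3}. v = 1}"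
    using assms by (intro size_obstructedI[of _ 1 1]) auto
  moreover have "size_obstructed n k {v \<in> {1..3}. v \<noteq> 1}"
    using assms by (intro size_obstructedI[of _ 2 3]) auto
  ultimately show "size_obstructed n k {v \<in> {1..3}. (v = 1) = col} \<or>
      residue_obstructed n k {v \<in> {1..3}. (v = 1) = col}" by (cases col) auto
qed

lemma avoids_ones_upto_4:
  assumes "n < k" "3 * n < 2 * k" "\<not> 3 dvd k - n"
  shows "\<not> has_mono_solution (replicate n 1) (replicate k 1) 4 (\<lambda>v. v \<in> {2, 3})"
proof (rule not_mono_ones_of_obstructed)
  fix col
  have "size_obstructed n k {v \<in> {1..4}. v \<in> {2, 3}}"
    using assms by (intro size_obstructedI[of _ 2 3]) auto
  moreover have "residue_obstructed n k {v \<in> {1..4}. v \<notin> {2, 3}}"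
  proof (rule residue_obstructedI[of _ 3])
    have "{v \<in> {1..4}. v \<notin> {2, 3}} = {1, 4 :: nat}" by auto
    then show "\<forall>v\<in>{v \<in> {1..4}. v \<notin> {2, 3}}. v mod 3 = (1 :: nat)" by simp
  qed (use assms in auto)
  ultimately show "size_obstructed n k {v \<in> {1..4}. (v \<in> {2, 3}) = col} \<or>
      residue_obstructed n k {v \<in> {1..4}. (v \<in> {2, 3}) = col}"
    by (cases col) (auto simp del: insert_iff)
qed

section \<open>Monochromatic solutions that cannot be avoided\<close>

text \<open>In every solution used below the \<open>x\<^sub>i\<close> take at most three values, so they are given by
  multiplicities \<open>a\<close>, \<open>b\<close>, \<open>e\<close>; a value that does not occur gets multiplicity 0 and a dummy color
  condition, which is why values are often repeated.  Positional instances name the multiplicities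
  first, then the values, and \<open>y\<close> last.\<close>

lemma const_solution_not_mono:
  assumes "\<not> has_mono_solution (replicate n 1) [k] r c"
    and "a + b + e = n" "a * p + b * q + e * s = k * y"
    and "{p, q, s, y} \<subseteq> {1..r}"
  shows "\<not> (c p = c y \<and> c q = c y \<and> c s = c y)"
proof
  assume same: "c p = c y \<and> c q = c y \<and> c s = c y"
  let ?xs = "replicate a p @ replicate b q @ replicate e s"
  have "length ?xs = n" "sum_list ?xs = k * y" using assms(2,3) by (auto simp: sum_list_replicate)
  moreover have "\<forall>v\<in>set ?xs. v \<in> {1..r} \<and> c v = c y" using assms(4) same by auto
  ultimately have "has_mono_solution (replicate n 1) [k] r c"
    unfolding has_mono_solution_const_iff using assms(4) by blast
  with assms(1) show False by simp
qed

text \<open>For the general equation it is enough to let one value \<open>p\<close> occur on both sides, together with a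
  second value on each side.\<close>

lemma ones_solution_not_mono:
  assumes "\<not> has_mono_solution (replicate n 1) (replicate k 1) r c"
    and "a + b = n" "a' + b' = k" "a * p + b * q = a' * p + b' * s"
    and "{p, q, s} \<subseteq> {1..r}"
  shows "\<not> (c q = c p \<and> c s = c p)"
proof
  assume same: "c q = c p \<and> c s = c p"
  let ?xs = "replicate a p @ replicate b q" and ?ys = "replicate a' p @ replicate b' s"
  have "length ?xs = n" "length ?ys = k" "sum_list ?xs = sum_list ?ys"
    using assms(2-4) by (auto simp: sum_list_replicate)
  moreover have "\<forall>v\<in>set ?xs \<union> set ?ys. v \<in> {1..r} \<and> c v = c p" using assms(5) same by auto
  ultimately have "has_mono_solution (replicate n 1) (replicate k 1) r c"
    unfolding has_mono_solution_ones_iff by blast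
  with assms(1) show False by simp
qed

text \<open>The steps by which the color of 1 determines the colors of 2, 3, 4 and 5.\<close>

locale avoiding_coloring =
  fixes n k r :: nat and c :: "nat \<Rightarrow> bool"
  assumes n_ge_2: "n \<ge> 2" and n_less_k: "n < k" and k_le: "k \<le> 2 * n"
    and avoids: "\<not> has_mono_solution (replicate n 1) [k] r c"
begin

lemmas not_mono = const_solution_not_mono[OF avoids]

text \<open>With \<open>y = t\<close>, take \<open>d\<close> of the \<open>x\<^sub>i\<close> equal to \<open>2 t\<close> and the other \<open>n - d = 2 n - k\<close> equal to \<open>t\<close>.\<close>

lemma double_differs:
  assumes "1 \<le> t" "2 * t \<le> r"
  shows "c (2 * t) \<noteq> c t"
proof -
  have "(2 * n - k) * t + (k - n) * (2 * t) = ((2 * n - k) + 2 * (k - n)) * t"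
    by (simp add: algebra_simps)
  also have "(2 * n - k) + 2 * (k - n) = k"
    using n_less_k k_le by linarith
  finally have "(2 * n - k) * t + (k - n) * (2 * t) + 0 * t = k * t" by simp
  then show ?thesis
    using not_mono[of "2 * n - k" "k - n" 0 t "2 * t" t t] n_less_k k_le assms by auto
qed

lemma two_differs: "r \<ge> 2 \<Longrightarrow> c 2 \<noteq> c 1"
  using double_differs[of 1] by simp

lemma four_agrees: "r \<ge> 4 \<Longrightarrow> c 4 = c 1"
  using double_differs[of 1] double_differs[of 2] by auto

lemma three_differs_from_one_even:
  assumes "r \<ge> 3" "even (k - n)"
  shows "c 3 \<noteq> c 1"
  using not_mono[of "n - (k - n) div 2" "(k - n) div 2" 0 1 3 1 1] n_less_k k_le assms
  by auto

text \<open>For \<open>d \<ge> 2\<close> the difference \<open>d\<close> is a sum of twos and at most one three, so \<open>y = 1\<close> works; for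
  \<open>d = 1\<close> one takes \<open>y = 3\<close> and \<open>4 + 4 + 4 + 3 + \<dots> + 3 = 3 (n + 1)\<close>, which needs \<open>n \<ge> 3\<close>.\<close>

lemma three_differs_from_one:
  assumes "r \<ge> 4" "\<not> (n = 2 \<and> k = 3)"
  shows "c 3 \<noteq> c 1"
proof (cases "even (k - n)")
  case True
  then show ?thesis using three_differs_from_one_even assms by simp
next
  case False
  show ?thesis
  proof (cases "k = n + 1")
    case True
    then show ?thesis
      using not_mono[of "n - 3" 3 0 3 4 4 3] four_agrees n_ge_2 assms by auto
  next
    case neq: False
    define j where "j = (k - n - 3) div 2"
    have j: "k = n + 2 * j + 3" using False neq n_less_k unfolding j_def by presburger
    then show ?thesis
      using not_mono[of "n - j - 1" j 1 1 3 4 1] four_agrees k_le assms by auto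
  qed
qed

lemma three_differs_from_two:
  assumes "r \<ge> 3" "2 * k \<le> 3 * n"
  shows "c 3 \<noteq> c 2"
  using not_mono[of "n - 2 * (k - n)" "2 * (k - n)" 0 2 3 2 2] n_less_k assms by auto

text \<open>With \<open>y = 2\<close> the excess \<open>2 d\<close> over \<open>2 n\<close> is spread over the \<open>x\<^sub>i\<close> in portions of 3 and 1;
  as \<open>d \<le> n\<close> and \<open>n \<ge> 2\<close>, taking at most two portions of 1 leaves no more than \<open>n\<close> portions.\<close>

lemma five_differs_from_two:
  assumes "r \<ge> 5" "c 3 = c 2"
  shows "c 5 \<noteq> c 2"
proof -
  define j i where "j = (2 * (k - n)) div 3" and "i = (2 * (k - n)) mod 3"
  have d: "2 * (k - n) = 3 * j + i" unfolding i_def j_def by simp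
  have "i < 3" unfolding i_def by simp
  then have ij: "i + j \<le> n" using d n_ge_2 n_less_k k_le by linarith
  have "(n - i - j) * 2 + i * 3 + j * 5 = 2 * n + i + 3 * j" using ij by linarith
  also have "\<dots> = k * 2" using d n_less_k by linarith
  finally show ?thesis
    using not_mono[of "n - i - j" i j 2 3 5 2] ij assms by auto
qed

lemma three_agrees_two_five_agrees_one:
  assumes "r \<ge> 5" "\<not> (n = 2 \<and> k = 3)"
  shows "c 3 = c 2" "c 5 = c 1"
proof -
  show c32: "c 3 = c 2" using three_differs_from_one two_differs assms by auto
  show "c 5 = c 1" using c32 five_differs_from_two two_differs assms by auto
qed

end

section \<open>The generic values\<close>

lemma mono_const_3:
  assumes "n \<ge> 2" "n < k" "2 * k \<le> 3 * n" "even (k - n)"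
  shows "has_mono_solution (replicate n 1) [k] 3 c"
proof (rule ccontr)
  assume "\<not> ?thesis"
  then interpret avoiding_coloring n k 3 c using assms by unfold_locales auto
  show False
    using three_differs_from_one_even three_differs_from_two two_differs assms by auto
qed

lemma mono_const_4_size:
  assumes "n \<ge> 2" "n < k" "2 * k \<le> 3 * n" "\<not> (n = 2 \<and> k = 3)"
  shows "has_mono_solution (replicate n 1) [k] 4 c"
proof (rule ccontr)
  assume "\<not> ?thesis"
  then interpret avoiding_coloring n k 4 c using assms by unfold_locales auto
  show False
    using three_differs_from_one three_differs_from_two two_differs assms by auto
qed

lemma mono_const_4_dvd:
  assumes "n \<ge> 2" "n < k" "k \<le> 2 * n" "3 dvd k - n"
  shows "has_mono_solution (replicate n 1) [k] 4 c"
proof (rule ccontr)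
  assume "\<not> ?thesis"
  then interpret avoiding_coloring n k 4 c using assms by unfold_locales auto
  from assms obtain j where "k = n + 3 * j" by (metis dvdE le_add_diff_inverse less_imp_le)
  then show False using not_mono[of "n - j" j 0 1 4 1 1] four_agrees assms by auto
qed

text \<open>Here \<open>d\<close> is a sum of threes and at most two fours, one or two according to its residue
  modulo 3.\<close>

lemma mono_const_5:
  assumes "n \<ge> 2" "n < k" "k \<le> 2 * n" "\<not> 3 dvd k - n" "k - n \<notin> {1, 2, 5}"
  shows "has_mono_solution (replicate n 1) [k] 5 c"
proof (rule ccontr)
  assume "\<not> ?thesis"
  then interpret avoiding_coloring n k 5 c using assms by unfold_locales auto
  have rep: "\<exists>i j. d = 3 * i + 4 * j" if "\<not> 3 dvd d" "d \<noteq> 1" "d \<noteq> 2" "d \<noteq> 5" for d :: nat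
  proof (cases "d mod 3 = 1")
    case True
    then have "d = 3 * ((d - 4) div 3) + 4 * 1" using that(2) by presburger
    then show ?thesis by blast
  next
    case False
    then have "d = 3 * ((d - 8) div 3) + 4 * 2" using that by presburger
    then show ?thesis by blast
  qed
  have "\<exists>i j. k - n = 3 * i + 4 * j" using rep[of "k - n"] assms(4,5) by simp
  then obtain i j where "k = n + 3 * i + 4 * j" using n_less_k
    by (metis add.assoc le_add_diff_inverse less_imp_le)
  then show False
    using not_mono[of "n - i - j" i j 1 4 5 1] four_agrees
      three_agrees_two_five_agrees_one assms by auto
qed

section \<open>The exceptional values\<close>

lemma mono_ones_2_3: "has_mono_solution (replicate 2 1) (replicate 3 1) 4 c"
proof (rule ccontr)
  assume a: "\<not> ?thesis"
  then interpret avoiding_coloring 2 3 4 c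
    using mono_const_imp_mono_ones by unfold_locales auto
  have "c 3 = c 1" using three_differs_from_two two_differs by auto
  then show False
    \<comment> \<open>\<open>1 + 4 = 1 + 1 + 3\<close>\<close>
    using ones_solution_not_mono[OF a, of 1 1 2 1 1 4 3] four_agrees by auto
qed

text \<open>A single 5 on the right suffices: \<open>4 + 4 + 1 + \<dots> = 5 + 1 + \<dots>\<close> when \<open>d = 2\<close>, and
  \<open>4 + 4 + 4 + 1 + \<dots> = 5 + 1 + \<dots>\<close> when \<open>d = 5\<close>.\<close>

lemma mono_ones_5:
  assumes "n \<ge> 2" "k \<le> 2 * n" "k = n + 2 \<or> k = n + 5"
  shows "has_mono_solution (replicate n 1) (replicate k 1) 5 c"
proof (rule ccontr)
  assume a: "\<not> ?thesis"
  then interpret avoiding_coloring n k 5 c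
    using assms mono_const_imp_mono_ones by unfold_locales auto
  have same: "c 4 = c 1" "c 5 = c 1"
    using four_agrees three_agrees_two_five_agrees_one assms by auto
  from assms(3) show False
  proof
    assume "k = n + 2"
    then show False
      using ones_solution_not_mono[OF a, of "n - 2" 2 "k - 1" 1 1 4 5] same assms by auto
  next
    assume "k = n + 5"
    then show False
      using ones_solution_not_mono[OF a, of "n - 3" 3 "k - 1" 1 1 4 5] same assms by auto
  qed
qed

text \<open>The element 6 can join neither class: \<open>6 + 1 + \<dots> + 1 = n + 5\<close>, and
  \<open>6 + 6 + 3 + 3 + 2 + \<dots> + 2 = 2 (n + 5)\<close>.\<close>

lemma mono_const_6:
  assumes "n \<ge> 5"
  shows "has_mono_solution (replicate n 1) [n + 5] 6 c"
proof (rule ccontr)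
  assume "\<not> ?thesis"
  then interpret avoiding_coloring n "n + 5" 6 c using assms by unfold_locales auto
  have "c 3 = c 2" "c 6 \<noteq> c 1" "c 6 \<noteq> c 2"
    using three_agrees_two_five_agrees_one
      not_mono[of "n - 1" 1 0 1 6 1 1] not_mono[of "n - 4" 2 2 2 3 6 2] assms by auto
  then show False using two_differs by auto
qed

text \<open>In the class \<open>{1,4,5}\<close>, \<open>y = 1\<close> would write 5 as a sum of threes and fours, and with \<open>y = 4\<close> or
  \<open>y = 5\<close> the mean of the \<open>x\<^sub>i\<close> would be at least \<open>4 (n + 5) / n > 5\<close>.  In \<open>{2,3}\<close> the mean would be at
  least \<open>2 (n + 5) / n > 3\<close>.\<close>

lemma avoids_const_5:
  assumes "n < 10"
  shows "\<not> has_mono_solution (replicate n 1) [n + 5] 5 (\<lambda>v. v = 2 \<or> v = 3)"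
proof
  assume "has_mono_solution (replicate n 1) [n + 5] 5 (\<lambda>v. v = 2 \<or> v = 3)"
  then obtain xs y where s: "length xs = n" "sum_list xs = (n + 5) * y" "y \<in> {1..5}"
    "\<forall>v\<in>set xs. v \<in> {1..5} \<and> (v = 2 \<or> v = 3) = (y = 2 \<or> y = 3)"
    unfolding has_mono_solution_const_iff by blast
  consider "y = 1" | "y = 2 \<or> y = 3" | "y = 4 \<or> y = 5" using s(3) by force
  then show False
  proof cases
    case 1
    \<comment> \<open>The numbers of 4s and 5s among the summands would give \<open>5 = 3 i + 4 j\<close>.\<close>
    have "\<exists>i j. sum_list xs = length xs + 3 * i + 4 * j"
      if "\<forall>v\<in>set xs. v = 1 \<or> v = 4 \<or> v = 5" for xs :: "nat list"
      using that
    proof (induction xs)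
      case (Cons x xs)
      then obtain i j where ij: "sum_list xs = length xs + 3 * i + 4 * j" by auto
      from Cons.prems consider "x = 1" | "x = 4" | "x = 5" by auto
      then show ?case
      proof cases
        case 1
        then show ?thesis using ij by auto
      next
        case 2
        then show ?thesis using ij by (intro exI[of _ "Suc i"] exI[of _ j]) simp
      next
        case 3
        then show ?thesis using ij by (intro exI[of _ i] exI[of _ "Suc j"]) simp
      qed
    qed simp
    moreover have "\<forall>v\<in>set xs. v = 1 \<or> v = 4 \<or> v = 5" using s(4) 1 by force
    ultimately obtain i j where "sum_list xs = length xs + 3 * i + 4 * j" by blast
    then have "5 = 3 * i + 4 * j" using s(1,2) 1 by simp
    then show False by presburger
  next
    case 2
    then have "\<forall>v\<in>set xs. v \<le> 3" using s(4) by auto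
    then have "sum_list xs \<le> n * 3" using sum_list_le_mult[of xs 3] s(1) by simp
    then show False using s(2) 2 assms by auto
  next
    case 3
    have "\<forall>v\<in>set xs. v \<le> 5" using s(4) by auto
    then have "sum_list xs \<le> n * 5" using sum_list_le_mult[of xs 5] s(1) by simp
    then show False using s(2) 3 assms by auto
  qed
qed

lemma avoids_constI:
  assumes "{1..r} \<subseteq> A \<union> B"
    and "\<And>xs y. length xs = n \<Longrightarrow> set xs \<subseteq> A \<Longrightarrow> y \<in> A \<Longrightarrow> sum_list xs \<noteq> k * y"
    and "\<And>xs y. length xs = n \<Longrightarrow> set xs \<subseteq> B \<Longrightarrow> y \<in> B \<Longrightarrow> sum_list xs \<noteq> k * y"
  shows "\<not> has_mono_solution (replicate n 1) [k] r (\<lambda>v. v \<in> A)"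
proof
  assume "has_mono_solution (replicate n 1) [k] r (\<lambda>v. v \<in> A)"
  then obtain xs y where s: "length xs = n" "sum_list xs = k * y" "y \<in> {1..r}"
    "\<forall>v\<in>set xs. v \<in> {1..r} \<and> (v \<in> A) = (y \<in> A)"
    unfolding has_mono_solution_const_iff by blast
  from s(3,4) assms(1) have "set xs \<subseteq> A \<and> y \<in> A \<or> set xs \<subseteq> B \<and> y \<in> B" by blast
  then show False using assms(2,3) s(1,2) by blast
qed

lemma sum_list_ne_mult_2:
  fixes X :: "nat set"
  assumes "length xs = 2" "set xs \<subseteq> X" "y \<in> X" "\<forall>p\<in>X. \<forall>q\<in>X. \<forall>y\<in>X. p + q \<noteq> k * y"
  shows "sum_list xs \<noteq> k * y"
proof -
  from assms(1) obtain p q where "xs = [p, q]" by (auto simp: numeral_2_eq_2 length_Suc_conv)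
  then show ?thesis using assms(2-4) by simp
qed

lemma sum_list_ne_mult_3:
  fixes X :: "nat set"
  assumes "length xs = 3" "set xs \<subseteq> X" "y \<in> X"
    "\<forall>p\<in>X. \<forall>q\<in>X. \<forall>t\<in>X. \<forall>y\<in>X. p + q + t \<noteq> k * y"
  shows "sum_list xs \<noteq> k * y"
proof -
  from assms(1) obtain p q t where "xs = [p, q, t]"
    by (auto simp: numeral_3_eq_3 length_Suc_conv)
  then show ?thesis using assms(2-4) by (simp add: add.assoc)
qed

text \<open>Starting from the color of 1, the solutions of the special equation force every other color, so
  these three colorings are unique up to exchanging the colors.\<close>

lemma avoids_const_2_3:
  "\<not> has_mono_solution (replicate 2 1) [3] 8 (\<lambda>v. v \<in> {1, 3, 4, 7})"
proof (rule avoids_constI[of _ _ "{2, 5, 6, 8}"])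
  show "{1..8} \<subseteq> {1, 3, 4, 7} \<union> {2, 5, 6, 8 :: nat}" by (simp add: numeral_eq_Suc atLeastAtMostSuc_conv)
qed (rule sum_list_ne_mult_2, assumption, assumption, assumption, simp)+

lemma avoids_const_2_4:
  "\<not> has_mono_solution (replicate 2 1) [4] 9 (\<lambda>v. v \<in> {1, 4, 5, 6, 9})"
proof (rule avoids_constI[of _ _ "{2, 3, 7, 8}"])
  show "{1..9} \<subseteq> {1, 4, 5, 6, 9} \<union> {2, 3, 7, 8 :: nat}" by (simp add: numeral_eq_Suc atLeastAtMostSuc_conv)
qed (rule sum_list_ne_mult_2, assumption, assumption, assumption, simp)+

lemma avoids_const_3_5:
  "\<not> has_mono_solution (replicate 3 1) [5] 8 (\<lambda>v. v \<in> {1, 4, 5, 6})"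
proof (rule avoids_constI[of _ _ "{2, 3, 7, 8}"])
  show "{1..8} \<subseteq> {1, 4, 5, 6} \<union> {2, 3, 7, 8 :: nat}" by (simp add: numeral_eq_Suc atLeastAtMostSuc_conv)
qed (rule sum_list_ne_mult_3, assumption, assumption, assumption, simp)+

text \<open>With the next integer added, no coloring is left: the forced colors violate the last fact that
  is listed in each of the three proofs.\<close>

lemma mono_const_2_3: "has_mono_solution (replicate 2 1) [3] 9 c"
proof (rule ccontr)
  assume "\<not> ?thesis"
  then interpret avoiding_coloring 2 3 9 c by unfold_locales auto
  have "c 2 \<noteq> c 1" "c 4 = c 1" using two_differs four_agrees by auto
  moreover have "c 3 \<noteq> c 2" using not_mono[of 2 0 0 3 3 3 2] by auto
  moreover have "c 6 \<noteq> c 3" using not_mono[of 1 1 0 3 6 3 3] by auto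
  moreover have "\<not> (c 3 = c 4 \<and> c 9 = c 4)" using not_mono[of 1 1 0 3 9 3 4] by auto
  moreover have "\<not> (c 4 = c 3 \<and> c 5 = c 3)" using not_mono[of 1 1 0 4 5 4 3] by auto
  moreover have "\<not> (c 6 = c 5 \<and> c 9 = c 5)" using not_mono[of 1 1 0 6 9 6 5] by auto
  ultimately show False by argo
qed

lemma mono_const_2_4: "has_mono_solution (replicate 2 1) [4] 10 c"
proof (rule ccontr)
  assume "\<not> ?thesis"
  then interpret avoiding_coloring 2 4 10 c by unfold_locales auto
  have "c 2 \<noteq> c 1" "c 4 = c 1" "c 3 = c 2"
    using two_differs four_agrees three_agrees_two_five_agrees_one by auto
  moreover have "c 6 \<noteq> c 2" using not_mono[of 1 1 0 2 6 2 2] by auto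
  moreover have "\<not> (c 2 = c 3 \<and> c 10 = c 3)" using not_mono[of 1 1 0 2 10 2 3] by auto
  moreover have "\<not> (c 6 = c 4 \<and> c 10 = c 4)" using not_mono[of 1 1 0 6 10 6 4] by auto
  ultimately show False by argo
qed

lemma mono_const_3_5: "has_mono_solution (replicate 3 1) [5] 9 c"
proof (rule ccontr)
  assume "\<not> ?thesis"
  then interpret avoiding_coloring 3 5 9 c by unfold_locales auto
  have "c 2 \<noteq> c 1" "c 4 = c 1" "c 3 = c 2" "c 5 = c 1"
    using two_differs four_agrees three_agrees_two_five_agrees_one by auto
  moreover have "c 6 \<noteq> c 2" using not_mono[of 2 1 0 2 6 2 2] by auto
  moreover have "c 9 \<noteq> c 3" using not_mono[of 2 1 0 3 9 3 3] by auto
  moreover have "\<not> (c 5 = c 4 \<and> c 6 = c 4 \<and> c 9 = c 4)" using not_mono[of 1 1 1 5 6 9 4] by auto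
  ultimately show False by argo
qed

section \<open>The comparison\<close>

lemma r2_eq_R2_generic:
  assumes "n \<ge> 2" "n < k" "k \<le> 2 * n"
    and "\<not> (n = 2 \<and> k = 3)" "\<not> (3 * n < 2 * k \<and> k - n \<in> {1, 2, 5})"
  shows "r2 n k = R2 (n + 1) k"
proof -
  consider (even) "2 * k \<le> 3 * n" "even (k - n)" | (odd) "2 * k \<le> 3 * n" "odd (k - n)"
    | (dvd_3) "3 * n < 2 * k" "3 dvd k - n" | (not_dvd_3) "3 * n < 2 * k" "\<not> 3 dvd k - n" by linarith
  then have "r2 n k = R2 (Suc n) k"
  proof cases
    case even
    then show ?thesis
      using assms mono_const_3 avoids_ones_upto_2
      by (intro r2_eq_R2I[of n k 2 "\<lambda>v. v = 1"]) auto
  next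
    case odd
    then show ?thesis
      using assms mono_const_4_size avoids_ones_upto_3_odd
      by (intro r2_eq_R2I[of n k 3 "\<lambda>v. v = 2"]) auto
  next
    case dvd_3
    then show ?thesis
      using assms mono_const_4_dvd avoids_ones_upto_3_size
      by (intro r2_eq_R2I[of n k 3 "\<lambda>v. v = 1"]) auto
  next
    case not_dvd_3
    then show ?thesis
      using assms mono_const_5 avoids_ones_upto_4
      by (intro r2_eq_R2I[of n k 4 "\<lambda>v. v \<in> {2, 3}"]) auto
  qed
  then show ?thesis by simp
qed

lemma r2_2_3: "r2 2 3 = 4"
  using r2_eqI[of 2 3 3 "\<lambda>v. v = 2"] mono_ones_2_3 avoids_ones_upto_3_odd[of 2 3] by simp

lemma r2_eq_5:
  assumes "n \<ge> 2" "k \<le> 2 * n" "3 * n < 2 * k" "k = n + 2 \<or> k = n + 5"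
  shows "r2 n k = 5"
proof -
  have "\<not> 3 dvd k - n" using assms(4) by auto
  then show ?thesis
    using r2_eqI[of n k 4 "\<lambda>v. v \<in> {2, 3}"] mono_ones_5[of n k] avoids_ones_upto_4[of n k]
      assms by auto
qed

lemma R2_3_3: "R2 3 3 = 9"
  using R2_eqI[OF _ avoids_const_2_3] mono_const_2_3 by (simp add: numeral_eq_Suc)

lemma R2_3_4: "R2 3 4 = 10"
  using R2_eqI[OF _ avoids_const_2_4] mono_const_2_4 by (simp add: numeral_eq_Suc)

lemma R2_4_5: "R2 4 5 = 9"
  using R2_eqI[OF _ avoids_const_3_5] mono_const_3_5 by (simp add: numeral_eq_Suc)

lemma R2_eq_6:
  assumes "5 \<le> n" "n < 10"
  shows "R2 (n + 1) (n + 5) = 6"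
  using R2_eqI[OF _ avoids_const_5] mono_const_6 assms by simp

theorem theorem2:
  fixes n k :: nat
  assumes "n \<ge> 2" and "k > n" and "k \<le> 2 * n"
  shows
    "(\<not> (n = 2 \<and> k = 3) \<and> \<not> (n = 2 \<and> k = 4) \<and> \<not> (n = 3 \<and> k = 5) \<and>
        \<not> (10 \<le> k \<and> k \<le> 14 \<and> n = k - 5) \<longrightarrow> r2 n k = R2 (n + 1) k)
     \<and> (r2 2 3 = 4 \<and> R2 3 3 = 9)
     \<and> (r2 2 4 = 5 \<and> R2 3 4 = 10)
     \<and> (r2 3 5 = 5 \<and> R2 4 5 = 9)
     \<and> (\<forall>l::nat. 10 \<le> l \<and> l \<le> 14 \<longrightarrow> r2 (l - 5) l = 5 \<and> R2 (l - 4) l = 6)"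
proof (intro conjI allI impI)
  assume ne: "\<not> (n = 2 \<and> k = 3) \<and> \<not> (n = 2 \<and> k = 4) \<and> \<not> (n = 3 \<and> k = 5) \<and>
        \<not> (10 \<le> k \<and> k \<le> 14 \<and> n = k - 5)"
  have "\<not> (3 * n < 2 * k \<and> k - n \<in> {1, 2, 5})"
  proof
    assume a: "3 * n < 2 * k \<and> k - n \<in> {1, 2, 5}"
    then consider "k = n + 1" | "k = n + 2" | "k = n + 5" using assms(2) by force
    then show False
    proof cases
      case 2
      then have "n = 2 \<or> n = 3" using a assms by auto
      then show False using 2 ne by auto
    qed (use a ne assms in auto)
  qed
  then show "r2 n k = R2 (n + 1) k" using r2_eq_R2_generic assms ne by blast
next
  fix l :: nat
  assume "10 \<le> l \<and> l \<le> 14"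
  then obtain m where m: "l = m + 5" "5 \<le> m" "m < 10"
    by (intro that[of "l - 5"]) auto
  show "r2 (l - 5) l = 5" using r2_eq_5[of m l] m by simp
  show "R2 (l - 4) l = 6" using R2_eq_6[of m] m by simp
qed (simp_all add: r2_2_3 r2_eq_5 R2_3_3 R2_3_4 R2_4_5)

end
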